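(* Let $\mathfrak{g}$ be a finite-dimensional complex Lie algebra, let $t\in\mathbb{C}$, and let $\mathfrak{g}\times^{\mathrm{ad}}_t\mathrm{Der}(\mathfrak{g})$ be the deformed Lie algebra corresponding to the crossed module $\mathrm{ad}:\mathfrak{g}\to\mathrm{Der}(\mathfrak{g})$. Suppose that $Z(\mathrm{Der}(\mathfrak{g}))\neq 0$. Then $\mathfrak{g}\times^{\mathrm{ad}}_t\mathrm{Der}(\mathfrak{g})$ is not isomorphic to the direct product Lie algebra $\mathfrak{g}\oplus\mathrm{Der}(\mathfrak{g})$.
   Context: $\mathrm{Der}(\mathfrak{g})$ is the Lie algebra of derivations of $\mathfrak{g}$ (with the commutator bracket), acting on $\mathfrak{g}$ by $D\cdot h=D(h)$, and $Z(\cdot)$ denotes the center of a Lie algebra. The deformed Lie algebra $\mathfrak{g}\times^{\mathrm{ad}}_t\mathrm{Der}(\mathfrak{g})$ is the vector space $\mathfrak{g}\oplus\mathrm{Der}(\mathfrak{g})$ with bracket $[(h,D),(h',D')]_t=(D(h')-D'(h),[D,D']+t\,\mathrm{ad}_{[h,h']})$. The direct product has bracket $[(h,D),(h',D')]=([h,h'],[D,D'])$. *)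

theory Defs
  imports Complex_Main "HOL-Library.Function_Algebras" "HOL-Library.Product_Plus"
begin

text \<open>
  A Lie algebra lives on a subspace of an ambient vector space: addition is that of the
  ambient type, and only the values of the bracket on \<open>lie_space\<close> matter.
\<close>

record ('k, 'v) lie_structure =
  lie_space :: "'v set"
  lie_scale :: "'k \<Rightarrow> 'v \<Rightarrow> 'v"
  lie_bracket :: "'v \<Rightarrow> 'v \<Rightarrow> 'v"

locale lie_algebra = vector_space "lie_scale G"
  for G :: "('k::field, 'v::ab_group_add) lie_structure" +
  assumes subspace_space: "subspace (lie_space G)"
    and bracket_closed:
      "\<lbrakk>x \<in> lie_space G; y \<in> lie_space G\<rbrakk> \<Longrightarrow> lie_bracket G x y \<in> lie_space G"
    and bracket_add_left:
      "\<lbrakk>x \<in> lie_space G; y \<in> lie_space G; z \<in> lie_space G\<rbrakk> \<Longrightarrow>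
        lie_bracket G (x + y) z = lie_bracket G x z + lie_bracket G y z"
    and bracket_add_right:
      "\<lbrakk>x \<in> lie_space G; y \<in> lie_space G; z \<in> lie_space G\<rbrakk> \<Longrightarrow>
        lie_bracket G x (y + z) = lie_bracket G x y + lie_bracket G x z"
    and bracket_scale_left:
      "\<lbrakk>x \<in> lie_space G; y \<in> lie_space G\<rbrakk> \<Longrightarrow>
        lie_bracket G (lie_scale G c x) y = lie_scale G c (lie_bracket G x y)"
    and bracket_scale_right:
      "\<lbrakk>x \<in> lie_space G; y \<in> lie_space G\<rbrakk> \<Longrightarrow>
        lie_bracket G x (lie_scale G c y) = lie_scale G c (lie_bracket G x y)"
    and bracket_self: "x \<in> lie_space G \<Longrightarrow> lie_bracket G x x = 0"
    and jacobi:
      "\<lbrakk>x \<in> lie_space G; y \<in> lie_space G; z \<in> lie_space G\<rbrakk> \<Longrightarrow>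
        lie_bracket G x (lie_bracket G y z) + lie_bracket G y (lie_bracket G z x)
          + lie_bracket G z (lie_bracket G x y) = 0"

locale finite_dim_lie_algebra = lie_algebra +
  assumes finite_dim: "\<exists>B. finite B \<and> span B = lie_space G"

definition lie_center :: "('k, 'v::zero) lie_structure \<Rightarrow> 'v set" where
  "lie_center G = {x \<in> lie_space G. \<forall>y \<in> lie_space G. lie_bracket G x y = 0}"

definition lie_isomorphism ::
  "('k, 'v::plus) lie_structure \<Rightarrow> ('k, 'w::plus) lie_structure \<Rightarrow> ('v \<Rightarrow> 'w) \<Rightarrow> bool" where
  "lie_isomorphism G H f \<longleftrightarrow>
     bij_betw f (lie_space G) (lie_space H) \<and>
     (\<forall>x \<in> lie_space G. \<forall>y \<in> lie_space G. f (x + y) = f x + f y) \<and>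
     (\<forall>c. \<forall>x \<in> lie_space G. f (lie_scale G c x) = lie_scale H c (f x)) \<and>
     (\<forall>x \<in> lie_space G. \<forall>y \<in> lie_space G.
        f (lie_bracket G x y) = lie_bracket H (f x) (f y))"

definition lie_isomorphic ::
  "('k, 'v::plus) lie_structure \<Rightarrow> ('k, 'w::plus) lie_structure \<Rightarrow> bool" where
  "lie_isomorphic G H \<longleftrightarrow> (\<exists>f. lie_isomorphism G H f)"

text \<open>
  Maps from \<open>lie_space G\<close> to itself are represented by functions on the ambient type that
  vanish outside \<open>lie_space G\<close>, so that equality of functions is equality of maps.
\<close>

definition derivations :: "('k, 'v::ab_group_add) lie_structure \<Rightarrow> ('v \<Rightarrow> 'v) set" where
  "derivations G = {D.
     (\<forall>x \<in> lie_space G. D x \<in> lie_space G) \<and>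
     (\<forall>x. x \<notin> lie_space G \<longrightarrow> D x = 0) \<and>
     (\<forall>x \<in> lie_space G. \<forall>y \<in> lie_space G. D (x + y) = D x + D y) \<and>
     (\<forall>c. \<forall>x \<in> lie_space G. D (lie_scale G c x) = lie_scale G c (D x)) \<and>
     (\<forall>x \<in> lie_space G. \<forall>y \<in> lie_space G.
        D (lie_bracket G x y) = lie_bracket G (D x) y + lie_bracket G x (D y))}"

definition Der :: "('k, 'v::ab_group_add) lie_structure \<Rightarrow> ('k, 'v \<Rightarrow> 'v) lie_structure" where
  "Der G = \<lparr>lie_space = derivations G,
            lie_scale = (\<lambda>c D x. lie_scale G c (D x)),
            lie_bracket = (\<lambda>D D'. (D \<circ> D') - (D' \<circ> D))\<rparr>"

definition ad :: "('k, 'v::zero) lie_structure \<Rightarrow> 'v \<Rightarrow> 'v \<Rightarrow> 'v" where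
  "ad G x = (\<lambda>y. if y \<in> lie_space G then lie_bracket G x y else 0)"

definition lie_direct_product ::
  "('k, 'v) lie_structure \<Rightarrow> ('k, 'w) lie_structure \<Rightarrow> ('k, 'v \<times> 'w) lie_structure" where
  "lie_direct_product G H =
     \<lparr>lie_space = lie_space G \<times> lie_space H,
      lie_scale = (\<lambda>c (x, y). (lie_scale G c x, lie_scale H c y)),
      lie_bracket = (\<lambda>(x, y) (x', y'). (lie_bracket G x x', lie_bracket H y y'))\<rparr>"

definition deformed_ad ::
  "('k, 'v::ab_group_add) lie_structure \<Rightarrow> 'k \<Rightarrow> ('k, 'v \<times> ('v \<Rightarrow> 'v)) lie_structure" where
  "deformed_ad G t =
     \<lparr>lie_space = lie_space G \<times> lie_space (Der G),
      lie_scale = (\<lambda>c (h, D). (lie_scale G c h, lie_scale (Der G) c D)),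
      lie_bracket = (\<lambda>(h, D) (h', D').
        (D h' - D' h,
         lie_bracket (Der G) D D' + lie_scale (Der G) t (ad G (lie_bracket G h h'))))\<rparr>"

context lie_algebra
begin

lemma space_intros:
  "0 \<in> lie_space G"
  "\<lbrakk>x \<in> lie_space G; y \<in> lie_space G\<rbrakk> \<Longrightarrow> x + y \<in> lie_space G"
  "\<lbrakk>x \<in> lie_space G; y \<in> lie_space G\<rbrakk> \<Longrightarrow> x - y \<in> lie_space G"
  "x \<in> lie_space G \<Longrightarrow> lie_scale G c x \<in> lie_space G"
  "x \<in> lie_space G \<Longrightarrow> - x \<in> lie_space G"
  by (simp_all add: subspace_0[OF subspace_space] subspace_add[OF subspace_space]
      subspace_diff[OF subspace_space] subspace_scale[OF subspace_space]
      subspace_neg[OF subspace_space])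

lemma bracket_anti:
  assumes x: "x \<in> lie_space G" and y: "y \<in> lie_space G"
  shows "lie_bracket G y x = - lie_bracket G x y"
proof -
  have "lie_bracket G (x + y) (x + y) = lie_bracket G y x + lie_bracket G x y"
    using x y by (simp add: bracket_add_left bracket_add_right space_intros
        bracket_self[OF x] bracket_self[OF y] add.commute)
  then have "lie_bracket G y x + lie_bracket G x y = 0"
    using bracket_self[OF space_intros(2)[OF x y]] by simp
  then show ?thesis by (rule eq_neg_iff_add_eq_0[THEN iffD2])
qed

lemma bracket_0:
  "x \<in> lie_space G \<Longrightarrow> lie_bracket G 0 x = 0"
  "x \<in> lie_space G \<Longrightarrow> lie_bracket G x 0 = 0"
  using bracket_scale_left[of 0 x 0] bracket_scale_right[of x 0 0]
  by (simp_all add: space_intros)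

lemma bracket_diff_left:
  "\<lbrakk>x \<in> lie_space G; y \<in> lie_space G; z \<in> lie_space G\<rbrakk> \<Longrightarrow>
    lie_bracket G (x - y) z = lie_bracket G x z - lie_bracket G y z"
  using bracket_add_left[of "x - y" y z] by (simp add: space_intros)

lemma bracket_diff_right:
  "\<lbrakk>x \<in> lie_space G; y \<in> lie_space G; z \<in> lie_space G\<rbrakk> \<Longrightarrow>
    lie_bracket G x (y - z) = lie_bracket G x y - lie_bracket G x z"
  using bracket_add_right[of x "y - z" z] by (simp add: space_intros)

lemma derivationsD:
  assumes "D \<in> derivations G"
  shows "x \<in> lie_space G \<Longrightarrow> D x \<in> lie_space G"
    and "x \<notin> lie_space G \<Longrightarrow> D x = 0"
    and "\<lbrakk>x \<in> lie_space G; y \<in> lie_space G\<rbrakk> \<Longrightarrow> D (x + y) = D x + D y"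
    and "x \<in> lie_space G \<Longrightarrow> D (lie_scale G c x) = lie_scale G c (D x)"
    and "\<lbrakk>x \<in> lie_space G; y \<in> lie_space G\<rbrakk> \<Longrightarrow>
      D (lie_bracket G x y) = lie_bracket G (D x) y + lie_bracket G x (D y)"
    and "D 0 = 0"
    and "\<lbrakk>x \<in> lie_space G; y \<in> lie_space G\<rbrakk> \<Longrightarrow> D (x - y) = D x - D y"
proof -
  have add: "D (x + y) = D x + D y" if "x \<in> lie_space G" "y \<in> lie_space G" for x y
    using assms that unfolding derivations_def by blast
  show "D 0 = 0" using add[of 0 0] space_intros(1) by simp
  show "D (x - y) = D x - D y" if "x \<in> lie_space G" "y \<in> lie_space G"
    using add[of "x - y" y] that by (simp add: space_intros algebra_simps)
qed (use assms in \<open>unfold derivations_def, blast\<close>)+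

lemma vector_space_Der: "vector_space (lie_scale (Der G))"
  by unfold_locales
    (auto simp: Der_def fun_eq_iff scale_right_distrib scale_left_distrib)

lemma derivations_0: "0 \<in> derivations G"
  by (auto simp: derivations_def space_intros bracket_0)

lemma derivations_add:
  "\<lbrakk>D \<in> derivations G; E \<in> derivations G\<rbrakk> \<Longrightarrow> D + E \<in> derivations G"
  by (subst derivations_def)
    (auto simp: derivationsD space_intros bracket_add_left bracket_add_right
      scale_right_distrib algebra_simps)

lemma derivations_scale:
  "D \<in> derivations G \<Longrightarrow> (\<lambda>x. lie_scale G c (D x)) \<in> derivations G"
  by (subst derivations_def)
    (auto simp: derivationsD space_intros bracket_scale_left bracket_scale_right
      scale_right_distrib scale_left_commute)

lemma derivations_commutator:
  "\<lbrakk>D \<in> derivations G; E \<in> derivations G\<rbrakk> \<Longrightarrow> (D \<circ> E) - (E \<circ> D) \<in> derivations G"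
  by (subst derivations_def)
    (auto simp: derivationsD space_intros bracket_diff_left bracket_diff_right
      bracket_0 bracket_closed scale_right_diff_distrib algebra_simps)

lemma ad_derivation: "x \<in> lie_space G \<Longrightarrow> ad G x \<in> derivations G"
proof (subst derivations_def, auto simp: ad_def space_intros bracket_closed
    bracket_add_right bracket_scale_right)
  fix y z assume x: "x \<in> lie_space G" and y: "y \<in> lie_space G" and z: "z \<in> lie_space G"
  have "lie_bracket G y (lie_bracket G z x) = - lie_bracket G y (lie_bracket G x z)"
    using x y z bracket_anti[OF x z] bracket_diff_right[of y 0 "lie_bracket G x z"]
      bracket_0(2)[OF y]
    by (simp add: bracket_closed space_intros)
  moreover have "lie_bracket G z (lie_bracket G x y) = - lie_bracket G (lie_bracket G x y) z"
    using x y z by (intro bracket_anti bracket_closed)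
  ultimately show "lie_bracket G x (lie_bracket G y z) =
      lie_bracket G (lie_bracket G x y) z + lie_bracket G y (lie_bracket G x z)"
    using jacobi[OF x y z] by (simp add: algebra_simps)
qed

theorem lie_algebra_Der: "lie_algebra (Der G)"
proof -
  interpret V: vector_space "lie_scale (Der G)" by (rule vector_space_Der)
  show ?thesis
  proof unfold_locales
    show "V.subspace (lie_space (Der G))"
      unfolding V.subspace_def
      by (auto simp: Der_def derivations_0 derivations_add derivations_scale)
    fix D E F c
    assume D: "D \<in> lie_space (Der G)"
    then have D': "D \<in> derivations G" by (simp add: Der_def)
    show "lie_bracket (Der G) D D = 0" by (simp add: Der_def)
    assume E: "E \<in> lie_space (Der G)"
    then have E': "E \<in> derivations G" by (simp add: Der_def)
    have in_space: "D x \<in> lie_space G" "E x \<in> lie_space G" for x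
      using D' E' derivationsD(1,2) space_intros(1) by metis+
    have scale: "D (lie_scale G c (E x)) = lie_scale G c (D (E x))"
        "E (lie_scale G c (D x)) = lie_scale G c (E (D x))" for x
      using D' E' in_space by (simp_all add: derivationsD)
    show "lie_bracket (Der G) D E \<in> lie_space (Der G)"
      using D' E' by (simp add: Der_def derivations_commutator)
    show "lie_bracket (Der G) (lie_scale (Der G) c D) E
        = lie_scale (Der G) c (lie_bracket (Der G) D E)"
      by (simp add: Der_def fun_eq_iff scale_right_diff_distrib scale)
    show "lie_bracket (Der G) D (lie_scale (Der G) c E)
        = lie_scale (Der G) c (lie_bracket (Der G) D E)"
      by (simp add: Der_def fun_eq_iff scale_right_diff_distrib scale)
    assume F: "F \<in> lie_space (Der G)"
    then have F': "F \<in> derivations G" by (simp add: Der_def)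
    have F_space: "F x \<in> lie_space G" for x
      using F' derivationsD(1,2) space_intros(1) by metis
    show "lie_bracket (Der G) (D + E) F = lie_bracket (Der G) D F + lie_bracket (Der G) E F"
      using F' in_space by (simp add: Der_def fun_eq_iff derivationsD)
    show "lie_bracket (Der G) D (E + F) = lie_bracket (Der G) D E + lie_bracket (Der G) D F"
      using D' in_space F_space by (simp add: Der_def fun_eq_iff derivationsD)
    show "lie_bracket (Der G) D (lie_bracket (Der G) E F)
        + lie_bracket (Der G) E (lie_bracket (Der G) F D)
        + lie_bracket (Der G) F (lie_bracket (Der G) D E) = 0"
      using D' E' F' in_space F_space
      by (simp add: Der_def fun_eq_iff derivationsD)
  qed
qed

theorem lie_algebra_deformed_ad: "lie_algebra (deformed_ad G t)"
proof -
  let ?S = "lie_space G" and ?b = "lie_bracket G" and ?s = "lie_scale G"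
  interpret V: vector_space "lie_scale (deformed_ad G t)"
    by unfold_locales
      (auto simp: deformed_ad_def Der_def fun_eq_iff scale_right_distrib scale_left_distrib)
  have space: "lie_space (deformed_ad G t) = ?S \<times> derivations G"
    by (simp add: deformed_ad_def Der_def)
  have scale: "lie_scale (deformed_ad G t) c (h, D) = (?s c h, \<lambda>x. ?s c (D x))" for c h D
    by (simp add: deformed_ad_def Der_def)
  have bracket: "lie_bracket (deformed_ad G t) (h, D) (h', D') =
      (D h' - D' h, \<lambda>x. D (D' x) - D' (D x) + ?s t (ad G (?b h h') x))" for h D h' D'
    by (simp add: deformed_ad_def Der_def fun_eq_iff)
  have der_space: "D x \<in> ?S" if "D \<in> derivations G" for D x
    using that derivationsD(1,2) space_intros(1) by metis
  have add_space: "ad G h x \<in> ?S" if "h \<in> ?S" for h x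
    using ad_derivation[OF that] by (rule der_space)
  have ad_add: "ad G (h + h') x = ad G h x + ad G h' x"
      and ad_diff: "ad G (h - h') x = ad G h x - ad G h' x"
      and ad_scale: "ad G (?s c h) x = ?s c (ad G h x)"
    if "h \<in> ?S" "h' \<in> ?S" for h h' c x
    using that by (auto simp: ad_def bracket_add_left bracket_diff_left bracket_scale_left)
  have ad_0: "ad G 0 x = 0" for x
    by (simp add: ad_def bracket_0)
  have der_ad: "D (ad G h x) = ad G (D h) x + ad G h (D x)"
    if "D \<in> derivations G" "h \<in> ?S" for D h x
    using that by (auto simp: ad_def derivationsD bracket_0 space_intros)
  have ad_ad: "ad G (?b h h') x = ad G h (ad G h' x) - ad G h' (ad G h x)"
    if "h \<in> ?S" "h' \<in> ?S" for h h' x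
    using der_ad[OF ad_derivation[OF that(1)] that(2), of x] that by (simp add: ad_def)
  have closed: "lie_bracket (deformed_ad G t) (h, D) (h', D') \<in> ?S \<times> derivations G"
    if "h \<in> ?S" "h' \<in> ?S" "D \<in> derivations G" "D' \<in> derivations G" for h D h' D'
  proof -
    have "(D \<circ> D') - (D' \<circ> D) + (\<lambda>x. ?s t (ad G (?b h h') x)) \<in> derivations G"
      using that by (intro derivations_add derivations_commutator derivations_scale
          ad_derivation bracket_closed)
    also have "(D \<circ> D') - (D' \<circ> D) + (\<lambda>x. ?s t (ad G (?b h h') x))
        = (\<lambda>x. D (D' x) - D' (D x) + ?s t (ad G (?b h h') x))"
      by (simp add: fun_eq_iff)
    finally show ?thesis using that by (simp add: bracket der_space space_intros)
  qed
  show ?thesis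
  proof unfold_locales
    show "V.subspace (lie_space (deformed_ad G t))"
      unfolding V.subspace_def
      by (auto simp: space scale zero_prod_def space_intros derivations_0 derivations_add
          derivations_scale)
    fix X Y Z c
    assume "X \<in> lie_space (deformed_ad G t)"
    then obtain h D where X: "X = (h, D)" and h: "h \<in> ?S" and D: "D \<in> derivations G"
      by (auto simp: space)
    show "lie_bracket (deformed_ad G t) X X = 0"
      by (simp add: X bracket bracket_self[OF h] ad_0 fun_eq_iff zero_prod_def)
    assume "Y \<in> lie_space (deformed_ad G t)"
    then obtain h' D' where Y: "Y = (h', D')" and h': "h' \<in> ?S" and D': "D' \<in> derivations G"
      by (auto simp: space)
    note [simp] = space scale bracket der_space space_intros bracket_closed add_space
      ad_add ad_diff ad_scale ad_0
    show "lie_bracket (deformed_ad G t) X Y \<in> lie_space (deformed_ad G t)"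
      using closed[OF h h' D D'] by (simp add: X Y)
    show "lie_bracket (deformed_ad G t) (lie_scale (deformed_ad G t) c X) Y
        = lie_scale (deformed_ad G t) c (lie_bracket (deformed_ad G t) X Y)"
      using h h' D D' by (simp add: X Y fun_eq_iff derivationsD bracket_scale_left
          scale_right_diff_distrib scale_right_distrib scale_left_commute mult.commute)
    show "lie_bracket (deformed_ad G t) X (lie_scale (deformed_ad G t) c Y)
        = lie_scale (deformed_ad G t) c (lie_bracket (deformed_ad G t) X Y)"
      using h h' D D' by (simp add: X Y fun_eq_iff derivationsD bracket_scale_right
          scale_right_diff_distrib scale_right_distrib scale_left_commute mult.commute)
    assume "Z \<in> lie_space (deformed_ad G t)"
    then obtain h'' D'' where Z: "Z = (h'', D'')" and h'': "h'' \<in> ?S"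
        and D'': "D'' \<in> derivations G"
      by (auto simp: space)
    note mem = h h' h'' D D' D''
    show "lie_bracket (deformed_ad G t) (X + Y) Z
        = lie_bracket (deformed_ad G t) X Z + lie_bracket (deformed_ad G t) Y Z"
      using mem by (simp add: X Y Z fun_eq_iff derivationsD bracket_add_left
          scale_right_distrib)
    show "lie_bracket (deformed_ad G t) X (Y + Z)
        = lie_bracket (deformed_ad G t) X Y + lie_bracket (deformed_ad G t) X Z"
      using mem by (simp add: X Y Z fun_eq_iff derivationsD bracket_add_right
          scale_right_distrib)
    have 1: "ad G (?b h' h'') h + ad G (?b h'' h) h' + ad G (?b h h') h'' = 0"
    proof -
      have "ad G (?b h' h'') h = - ?b h (?b h' h'')"
           "ad G (?b h'' h) h' = - ?b h' (?b h'' h)"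
           "ad G (?b h h') h'' = - ?b h'' (?b h h')"
        using mem by (auto simp: ad_def intro!: bracket_anti)
      moreover have "- ?b h (?b h' h'') + - ?b h' (?b h'' h) + - ?b h'' (?b h h')
          = - (?b h (?b h' h'') + ?b h' (?b h'' h) + ?b h'' (?b h h'))"
        by simp
      ultimately show ?thesis using jacobi[OF h h' h''] by simp
    qed
    have 2: "?s t (ad G (?b h' h'') h) + ?s t (ad G (?b h'' h) h') + ?s t (ad G (?b h h') h'') = 0"
      using arg_cong[OF 1, of "?s t"] by (simp add: scale_right_distrib)
    have fst: "D (D' h'' - D'' h')
          - (D' (D'' h) - D'' (D' h) + ?s t (ad G (?b h' h'') h))
        + (D' (D'' h - D h'') - (D'' (D h') - D (D'' h') + ?s t (ad G (?b h'' h) h')))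
        + (D'' (D h' - D' h) - (D (D' h'') - D' (D h'') + ?s t (ad G (?b h h') h''))) = 0"
      (is "?lhs = 0")
    proof -
      have "?lhs = - (?s t (ad G (?b h' h'') h) + ?s t (ad G (?b h'' h) h')
          + ?s t (ad G (?b h h') h''))"
        using mem by (simp add: derivationsD del: ad_add ad_diff ad_scale)
      then show ?thesis using 2 by simp
    qed
    define A where "A a b x = ?s t (ad G (?b a b) x)" for a b x
    have A_diff: "A a (b - c) x = A a b x - A a c x" and A_anti: "A b a x = - A a b x"
      and A_D: "E (A a b x) = A (E a) b x + A a (E b) x + A a b (E x)"
      if "a \<in> ?S" "b \<in> ?S" "c \<in> ?S" "E \<in> derivations G" for E a b c x
    proof -
      show "A a (b - c) x = A a b x - A a c x"
        using that by (simp add: A_def bracket_diff_right scale_right_diff_distrib)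
      have "?b b a = 0 - ?b a b" using bracket_anti[OF that(1,2)] by simp
      then show "A b a x = - A a b x"
        using ad_diff[of 0 "?b a b" x] bracket_closed[OF that(1,2)]
        by (simp add: A_def del: ad_diff)
      show "E (A a b x) = A (E a) b x + A a (E b) x + A a b (E x)"
        using that by (simp add: A_def derivationsD der_ad scale_right_distrib)
    qed
    have snd: "D (D' (D'' x) - D'' (D' x) + A h' h'' x)
          - (D' (D'' (D x)) - D'' (D' (D x)) + A h' h'' (D x)) + A h (D' h'' - D'' h') x
        + (D' (D'' (D x) - D (D'' x) + A h'' h x)
          - (D'' (D (D' x)) - D (D'' (D' x)) + A h'' h (D' x)) + A h' (D'' h - D h'') x)
        + (D'' (D (D' x) - D' (D x) + A h h' x)
          - (D (D' (D'' x)) - D' (D (D'' x)) + A h h' (D'' x)) + A h'' (D h' - D' h) x) = 0"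
      for x
    proof -
      have [simp]: "A a b x \<in> ?S" if "a \<in> ?S" "b \<in> ?S" for a b x
        using that by (simp add: A_def)
      have "A h (D'' h') x = - A (D'' h') h x" "A h' (D h'') x = - A (D h'') h' x"
          "A h'' (D' h) x = - A (D' h) h'' x" "A h (D' h'') x = - A (D' h'') h x"
          "A h' (D'' h) x = - A (D'' h) h' x" "A h'' (D h') x = - A (D h') h'' x"
        by (rule A_anti[OF der_space[OF D''] h h D] A_anti[OF der_space[OF D] h' h D]
            A_anti[OF der_space[OF D'] h'' h D] A_anti[OF der_space[OF D'] h h D]
            A_anti[OF der_space[OF D''] h' h D] A_anti[OF der_space[OF D] h'' h D])+
      then show ?thesis
        using mem by (simp add: derivationsD A_D A_diff del: ad_add ad_diff ad_scale)
    qed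
    show "lie_bracket (deformed_ad G t) X (lie_bracket (deformed_ad G t) Y Z)
        + lie_bracket (deformed_ad G t) Y (lie_bracket (deformed_ad G t) Z X)
        + lie_bracket (deformed_ad G t) Z (lie_bracket (deformed_ad G t) X Y) = 0"
      using fst snd by (simp add: X Y Z fun_eq_iff zero_prod_def A_def
          del: ad_add ad_diff ad_scale)
  qed
qed

end

theorem lie_algebra_direct_product:
  assumes "lie_algebra G" and "lie_algebra H"
  shows "lie_algebra (lie_direct_product G H)"
proof -
  interpret A: lie_algebra G by fact
  interpret B: lie_algebra H by fact
  interpret V: vector_space "lie_scale (lie_direct_product G H)"
    by unfold_locales
      (auto simp: lie_direct_product_def A.scale_right_distrib A.scale_left_distrib
        B.scale_right_distrib B.scale_left_distrib)
  show ?thesis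
  proof unfold_locales
    show "V.subspace (lie_space (lie_direct_product G H))"
      unfolding V.subspace_def
      by (auto simp: lie_direct_product_def zero_prod_def
          A.space_intros B.space_intros)
  qed (auto simp: lie_direct_product_def zero_prod_def
      A.bracket_closed A.bracket_add_left A.bracket_add_right A.bracket_scale_left
      A.bracket_scale_right A.bracket_self A.jacobi
      B.bracket_closed B.bracket_add_left B.bracket_add_right B.bracket_scale_left
      B.bracket_scale_right B.bracket_self B.jacobi)
qed

end

theory Submission
  imports Defs
begin

text \<open>
  The two algebras are told apart by the size of their centers. The center of the direct
  product is \<open>Z(\<gg>) \<oplus> Z(Der(\<gg>))\<close>. In the deformed algebra, bracketing
  \<open>(h, D)\<close> with \<open>(0, D')\<close> gives first component \<open>- D'(h)\<close>, so every derivation kills the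
  first component of a central element; bracketing with \<open>(h', 0)\<close> then forces \<open>D = 0\<close>, and
  the inner derivations place \<open>h\<close> in \<open>Z(\<gg>)\<close>. So the center of the deformed algebra
  embeds in \<open>Z(\<gg>)\<close>, whatever \<open>t\<close> is.

  An isomorphism would therefore embed \<open>Z(\<gg>) \<oplus> Z(Der(\<gg>))\<close> linearly in
  \<open>Z(\<gg>)\<close>, which is impossible when \<open>Z(\<gg>)\<close> is finite-dimensional and
  \<open>Z(Der(\<gg>)) \<noteq> 0\<close>. Dimensions of the product are not computed: the restriction of the embedding
  to \<open>Z(\<gg>) \<oplus> 0\<close> is an injective endomorphism of \<open>Z(\<gg>)\<close>, hence already
  surjective, which leaves no room for the image of \<open>0 \<oplus> Z(Der(\<gg>))\<close>.
\<close>

text \<open>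
  The map is only assumed linear on the subspace. Replacing it by the linear extension of its
  values on a basis makes the results on globally linear maps applicable: the image of a basis
  is independent of the same cardinality, so by the exchange lemma it spans.
\<close>

lemma (in vector_space) finite_dim_injective_endomorphism_surj:
  assumes sub: "subspace S" and fin: "finite T" and ST: "S \<subseteq> span T"
    and add: "\<And>x y. \<lbrakk>x \<in> S; y \<in> S\<rbrakk> \<Longrightarrow> f (x + y) = f x + f y"
    and scl: "\<And>c x. x \<in> S \<Longrightarrow> f (scale c x) = scale c (f x)"
    and into: "f ` S \<subseteq> S" and inj: "inj_on f S"
  shows "f ` S = S"
proof -
  interpret P: vector_space_pair scale scale ..
  obtain B where B: "B \<subseteq> S" "independent B" "S \<subseteq> span B"
    using maximal_independent_subset by blast
  have finB: "finite B"
    using independent_span_bound[OF fin B(2)] B(1) ST by blast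
  have spanB: "span B = S"
    using B(1,3) span_minimal[OF B(1) sub] by blast
  define F where "F = P.construct B f"
  have linF: "Vector_Spaces.linear scale scale F"
    unfolding F_def by (rule P.linear_construct[OF B(2)])
  have Ff: "F x = f x" if "x \<in> S" for x
  proof -
    have "x \<in> S \<and> F x = f x" if "x \<in> span B"
      using that
    proof (induction rule: span_induct_alt)
      case base
      have "f 0 = 0" using add[of 0 0] subspace_0[OF sub] by simp
      then show ?case using P.linear_0[OF linF] subspace_0[OF sub] by simp
    next
      case (step c x y)
      then have "x \<in> S" using B(1) by blast
      moreover have "F x = f x"
        unfolding F_def by (rule P.construct_basis[OF B(2) step(1)])
      ultimately show ?case
        using step sub add[of "scale c x" y] scl[of x c]
        by (simp add: P.linear_add[OF linF] P.linear_scale[OF linF] subspace_add subspace_scale)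
    qed
    then show ?thesis using that spanB by simp
  qed
  have injF: "inj_on F (span B)"
    using inj Ff spanB by (simp add: inj_on_def)
  have ind: "independent (F ` B)"
    by (rule P.linear_independent_injective_image[OF linF B(2) injF])
  have FB: "F ` B \<subseteq> span B"
    using into Ff B(1) spanB by auto
  have cardF: "card (F ` B) = card B"
    using injF B(1) spanB by (metis card_image inj_on_subset)
  have "S \<subseteq> span (F ` B)"
  proof
    fix w assume w: "w \<in> S"
    show "w \<in> span (F ` B)"
    proof (rule ccontr)
      assume out: "w \<notin> span (F ` B)"
      have "independent (insert w (F ` B))"
        using independent_insertI[OF out ind] .
      moreover have "insert w (F ` B) \<subseteq> span B"
        using w FB spanB by blast
      ultimately have "card (insert w (F ` B)) \<le> card B"
        using independent_span_bound[OF finB] by blast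
      moreover have "w \<notin> F ` B" using out span_base by blast
      ultimately show False using finB cardF by simp
    qed
  qed
  moreover have "span (F ` B) = F ` S"
    using P.linear_span_image[OF linF, of B] spanB by simp
  moreover have "F ` S = f ` S" using Ff by simp
  ultimately show ?thesis using into by blast
qed

lemma lie_isomorphism_center:
  assumes iso: "lie_isomorphism G H f" and f0: "f 0 = 0" and x: "x \<in> lie_center G"
  shows "f x \<in> lie_center H"
proof -
  have "lie_bracket H (f x) z = 0" if z: "z \<in> lie_space H" for z
  proof -
    obtain y where y: "y \<in> lie_space G" "z = f y"
      using iso z unfolding lie_isomorphism_def bij_betw_def by blast
    then show ?thesis
      using iso x f0 unfolding lie_isomorphism_def lie_center_def by force
  qed
  moreover have "f x \<in> lie_space H"
    using iso x unfolding lie_isomorphism_def lie_center_def bij_betw_def by blast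
  ultimately show ?thesis unfolding lie_center_def by blast
qed

lemma lie_isomorphism_inv:
  assumes G: "lie_algebra G" and iso: "lie_isomorphism G H f"
  shows "lie_isomorphism H G (inv_into (lie_space G) f)"
proof -
  interpret lie_algebra G by fact
  let ?g = "inv_into (lie_space G) f"
  have bij: "bij_betw f (lie_space G) (lie_space H)"
    using iso unfolding lie_isomorphism_def by blast
  have g: "?g y \<in> lie_space G" "f (?g y) = y" if "y \<in> lie_space H" for y
    using bij that by (auto simp: bij_betw_def inv_into_into f_inv_into_f)
  have gf: "?g y = x" if "x \<in> lie_space G" "f x = y" for x y
    using bij that by (auto simp: bij_betw_def)
  show ?thesis
    unfolding lie_isomorphism_def
  proof (intro conjI ballI allI)
    show "bij_betw ?g (lie_space H) (lie_space G)"
      using bij by (rule bij_betw_inv_into)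
    fix x y c assume x: "x \<in> lie_space H"
    show "?g (lie_scale H c x) = lie_scale G c (?g x)"
      using iso g x by (intro gf) (auto simp: lie_isomorphism_def space_intros)
    assume y: "y \<in> lie_space H"
    show "?g (x + y) = ?g x + ?g y"
      using iso g x y by (intro gf) (auto simp: lie_isomorphism_def space_intros)
    show "?g (lie_bracket H x y) = lie_bracket G (?g x) (?g y)"
      using iso g x y by (intro gf) (auto simp: lie_isomorphism_def bracket_closed)
  qed
qed

lemma (in lie_algebra) subspace_lie_center: "subspace (lie_center G)"
  by (rule subspaceI)
    (auto simp: lie_center_def space_intros bracket_0 bracket_add_left bracket_scale_left)

lemma lie_center_direct_product:
  assumes "lie_algebra G" and "lie_algebra H"
  shows "lie_center (lie_direct_product G H) = lie_center G \<times> lie_center H"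
proof -
  have "0 \<in> lie_space G" "0 \<in> lie_space H"
    using assms by (auto intro: lie_algebra.space_intros)
  then show ?thesis
    by (auto simp: lie_center_def lie_direct_product_def zero_prod_def)
qed

text \<open>
  The parameter \<open>t\<close> enters only the second component of the bracket, and the vanishing of the
  first component alone is enough: \<open>D(h') = D'(h)\<close> for all \<open>h'\<close> and \<open>D'\<close> separates, by taking
  \<open>h' = 0\<close> or \<open>D' = 0\<close>, into \<open>D' h = 0\<close> for every derivation and \<open>D = 0\<close>.
\<close>

lemma (in lie_algebra) lie_center_deformed_ad_subset:
  "lie_center (deformed_ad G t) \<subseteq> lie_center G \<times> {0}"
proof
  fix X assume "X \<in> lie_center (deformed_ad G t)"
  then obtain h D where X: "X = (h, D)" and h: "h \<in> lie_space G" and D: "D \<in> derivations G"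
    and central: "\<And>h' D'. \<lbrakk>h' \<in> lie_space G; D' \<in> derivations G\<rbrakk> \<Longrightarrow> D h' - D' h = 0"
    by (auto simp: lie_center_def deformed_ad_def Der_def zero_prod_def)
  have "D' h = 0" if "D' \<in> derivations G" for D'
    using central[OF space_intros(1) that] derivationsD(6)[OF D] by simp
  then have "lie_bracket G y h = 0" if "y \<in> lie_space G" for y
    using ad_derivation[OF that] h by (metis ad_def)
  then have "h \<in> lie_center G"
    using h bracket_anti[of _ h] by (simp add: lie_center_def)
  moreover have "D h' = 0" for h'
    using central[of h' 0] derivations_0 derivationsD(2)[OF D, of h']
    by (cases "h' \<in> lie_space G") simp_all
  ultimately show "X \<in> lie_center G \<times> {0}"
    by (auto simp: X fun_eq_iff)
qed

theorem corollary4p10: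
  fixes G :: "(complex, 'v::ab_group_add) lie_structure" and t :: complex
  assumes "finite_dim_lie_algebra G"
    and "lie_center (Der G) \<noteq> {0}"
  shows "\<not> lie_isomorphic (deformed_ad G t) (lie_direct_product G (Der G))"
proof
  interpret finite_dim_lie_algebra G by fact
  interpret D: lie_algebra "Der G" by (rule lie_algebra_Der)
  let ?P = "lie_direct_product G (Der G)" and ?Z = "lie_center G"
  assume "lie_isomorphic (deformed_ad G t) ?P"
  then obtain g where g: "lie_isomorphism ?P (deformed_ad G t) g"
    unfolding lie_isomorphic_def using lie_isomorphism_inv[OF lie_algebra_deformed_ad] by blast
  have space: "lie_space ?P = lie_space G \<times> lie_space (Der G)"
    by (simp add: lie_direct_product_def)
  have g_add: "g (x + y) = g x + g y" if "x \<in> lie_space ?P" "y \<in> lie_space ?P" for x y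
    using g that unfolding lie_isomorphism_def by blast
  have g_scale: "g (lie_scale ?P c x) = lie_scale (deformed_ad G t) c (g x)"
    if "x \<in> lie_space ?P" for c x
    using g that unfolding lie_isomorphism_def by blast
  have g_inj: "inj_on g (lie_space ?P)"
    using g unfolding lie_isomorphism_def bij_betw_def by blast
  have "g 0 = 0"
    using g_add[of 0 0] by (simp add: space zero_prod_def space_intros D.space_intros)
  then have g_center: "g (z, E) \<in> ?Z \<times> {0}" if "z \<in> ?Z" "E \<in> lie_center (Der G)" for z E
    using lie_isomorphism_center[OF g] that lie_center_deformed_ad_subset[of t]
      lie_center_direct_product[OF lie_algebra_axioms D.lie_algebra_axioms] by blast
  have Z_space: "z \<in> lie_space G" if "z \<in> ?Z" for z
    using that by (simp add: lie_center_def)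
  have E0: "0 \<in> lie_center (Der G)"
    by (rule D.subspace_0[OF D.subspace_lie_center])
  have Z0: "0 \<in> ?Z"
    by (rule subspace_0[OF subspace_lie_center])
  obtain E where E: "E \<in> lie_center (Der G)" "E \<noteq> 0"
    using assms(2) E0 by blast
  \<comment> \<open>If \<open>\<phi>\<close> is onto, \<open>g (0, E)\<close> is already the image of some \<open>(z, 0)\<close>.\<close>
  define \<phi> where "\<phi> z = fst (g (z, 0))" for z
  have g_\<phi>: "g (z, 0) = (\<phi> z, 0)" and \<phi>_Z: "\<phi> z \<in> ?Z" if "z \<in> ?Z" for z
    using g_center[OF that E0] by (auto simp: \<phi>_def)
  have "\<phi> ` ?Z = ?Z"
  proof -
    obtain T where T: "finite T" "span T = lie_space G"
      using finite_dim by blast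
    show ?thesis
    proof (rule finite_dim_injective_endomorphism_surj[OF subspace_lie_center T(1)])
      show "?Z \<subseteq> span T" using T(2) Z_space by blast
      show "\<phi> ` ?Z \<subseteq> ?Z" using \<phi>_Z by blast
      show "inj_on \<phi> ?Z"
      proof (rule inj_onI)
        fix x y assume "x \<in> ?Z" "y \<in> ?Z" "\<phi> x = \<phi> y"
        then have "g (x, 0) = g (y, 0)" by (simp add: g_\<phi>)
        then have "(x, 0 :: 'v \<Rightarrow> 'v) = (y, 0)"
          using \<open>x \<in> ?Z\<close> \<open>y \<in> ?Z\<close>
          by (auto simp: space Z_space D.space_intros
              dest: inj_onD[OF g_inj, of "(x, 0)" "(y, 0)"])
        then show "x = y" by simp
      qed
    next
      fix x y assume "x \<in> ?Z" "y \<in> ?Z"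
      then show "\<phi> (x + y) = \<phi> x + \<phi> y"
        using g_add[of "(x, 0)" "(y, 0)"] by (simp add: \<phi>_def space Z_space D.space_intros)
    next
      fix c x assume x: "x \<in> ?Z"
      have "lie_scale ?P c (x, 0) = (lie_scale G c x, 0)"
        using D.scale_zero_right[of c] by (simp add: lie_direct_product_def)
      then have "g (lie_scale G c x, 0) = lie_scale (deformed_ad G t) c (\<phi> x, 0)"
        using g_scale[of "(x, 0)" c] x by (simp add: g_\<phi> space Z_space D.space_intros)
      then show "\<phi> (lie_scale G c x) = lie_scale G c (\<phi> x)"
        by (simp add: \<phi>_def[of "lie_scale G c x"] deformed_ad_def)
    qed
  qed
  moreover obtain w where w: "w \<in> ?Z" "g (0, E) = (w, 0)"
    using g_center[OF Z0 E(1)] by auto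
  ultimately obtain z where z: "z \<in> ?Z" "\<phi> z = w"
    by (metis imageE)
  then have eq: "g (z, 0) = g (0, E)" using g_\<phi> w by simp
  have "E \<in> lie_space (Der G)" using E(1) unfolding lie_center_def by blast
  then have "(0, E) \<in> lie_space ?P"
    unfolding space using space_intros(1) by blast
  moreover have "(z, 0) \<in> lie_space ?P"
    unfolding space using Z_space[OF z(1)] D.space_intros(1) by blast
  ultimately have "(z, 0) = (0, E)"
    using inj_onD[OF g_inj eq] by blast
  then show False using E(2) by blast
qed

end
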